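(* Let $s\ge 1$ and let $c_1,\dots,c_s\in\mathbb{R}$ be any distinct collocation parameters. Then the $s$-stage (collocation) GEPTRKN method based on $(c_i)_{i=1}^s$, applied to $y''=f(t,y,y')$, $y(t_0)=y_0$, $y'(t_0)=y_0'$, has stage order $r=s$ and step order $p=s$.
   Context: Problem: $y''(t)=f(t,y(t),y'(t))$, $y(t_0)=y_0$, $y'(t_0)=y_0'$ on $[t_0,t_0+T]$ (scalar form), where $f:[t_0,t_0+T]\times\mathbb{R}\times\mathbb{R}\to\mathbb{R}$, $f(t,y,z)$, is continuous in $t$ and Lipschitz in $(y,z)$, and $f$ and the exact solution $y$ are sufficiently smooth (i.e. have as many continuous derivatives as needed, the number depending only on $s$). All points at which $f$ and $y$ are evaluated are assumed to lie in the interval where they are defined. Notation: $\bm{c}=(c_1,\dots,c_s)^T$, $\bm{e}=(1,\dots,1)^T\in\mathbb{R}^s$; powers $\bm{c}^k$, $(\bm{c}-\bm{e})^k$ of vectors are componentwise (with zeroth power $\bm{e}$), and scalar functions are applied to vectors componentwise, e.g. $f(\bm{e}t+\bm{c}h,\bm{Y},\bm{Y}')=(f(t+c_ih,Y_i,Y_i'))_{i=1}^s$. GEPTRKN method: with step-size $h>0$, $t_{n+1}=t_n+h$, from $y_n\approx y(t_n)$, $y_n'\approx y'(t_n)$, $\bm{Y}_n\approx y(\bm{e}t_n+\bm{c}h)$, $\bm{Y}_n'\approx y'(\bm{e}t_n+\bm{c}h)$ one sets $F_n=f(\bm{e}t_n+\bm{c}h,\bm{Y}_n,\bm{Y}_n')$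 and $$y_{n+1}=y_n+hy_n'+h^2\bm{b}^TF_n,\quad y'_{n+1}=y'_n+h\bm{d}^TF_n,$$ $$\bm{Y}_{n+1}=\bm{e}y_{n+1}+h\bm{c}y'_{n+1}+h^2\bm{A}F_n,\quad \bm{Y}'_{n+1}=\bm{e}y'_{n+1}+h\bm{B}F_n.$$ Here $\bm{b},\bm{d}\in\mathbb{R}^s$ and $\bm{A},\bm{B}\in\mathbb{R}^{s\times s}$ are the coefficients uniquely determined by the collocation conditions, for $k=0,\dots,s-1$: $$1=(k+2)(k+1)\bm{b}^T\bm{c}^k,\quad 1=(k+1)\bm{d}^T\bm{c}^k,\quad \bm{c}^{k+2}=(k+2)(k+1)\bm{A}(\bm{c}-\bm{e})^k,\quad \bm{c}^{k+1}=(k+1)\bm{B}(\bm{c}-\bm{e})^k.$$ Order: the method has step order $p=\min\{p_1,p_2\}$ and stage order $r=\min\{p_1,p_2,p_3,p_4\}$ if $y(t_{n+1})-y_{n+1}=O(h^{p_1+1})$, $y'(t_{n+1})-y'_{n+1}=O(h^{p_2+1})$, $y(\bm{e}t_{n+1}+\bm{c}h)-\bm{Y}_{n+1}=O(h^{p_3+1})$, $y'(\bm{e}t_{n+1}+\bm{c}h)-\bm{Y}'_{n+1}=O(h^{p_4+1})$ as $h\to0$, given that $y_n=y(t_n)+O(h^{p_1+1})$, $y'_n=y'(t_n)+O(h^{p_2+1})$, $y(\bm{e}t_n+\bm{c}h)-\bm{Y}_n=O(h^{p_3+1})$, $y'(\bm{e}t_n+\bm{c}h)-\bm{Y}'_n=O(h^{p_4+1})$.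 This is a one-step notion: the constants in the conclusion depend only on the problem, the method and the constants in the hypotheses. "Has order $q$" is understood in the sense that such estimates hold (order at least $q$). *)

theory Defs
  imports "HOL-Analysis.Analysis"
begin

text \<open>
  Stage vectors live in \<open>real^'s\<close>, with \<open>CARD('s)\<close> the number of stages.  The ring
  structure of this type is componentwise, so that \<open>1\<close> is the vector of ones and \<open>c ^ k\<close>
  is the componentwise power.
\<close>

text \<open>
  \<open>k\<close> times continuously differentiable on \<open>S\<close>.  Derivatives are taken within \<open>S\<close>
  (one-sided at the boundary); on the sets used here, products of a nondegenerate compact
  interval with whole spaces, they are unique.
\<close>

primrec Ck_on :: "nat \<Rightarrow> 'a::euclidean_space set \<Rightarrow> ('a \<Rightarrow> real) \<Rightarrow> bool" where
  "Ck_on 0 S g \<longleftrightarrow> continuous_on S g"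
| "Ck_on (Suc k) S g \<longleftrightarrow>
     (\<exists>D. (\<forall>x\<in>S. (g has_derivative D x) (at x within S)) \<and>
          (\<forall>v\<in>Basis. Ck_on k S (\<lambda>x. D x v)))"

definition admissible_rhs :: "real \<Rightarrow> real \<Rightarrow> (real \<Rightarrow> real \<Rightarrow> real \<Rightarrow> real) \<Rightarrow> bool" where
  "admissible_rhs t0 T f \<longleftrightarrow>
     (\<forall>u z. continuous_on {t0..t0+T} (\<lambda>t. f t u z)) \<and>
     (\<exists>L. \<forall>t\<in>{t0..t0+T}. L-lipschitz_on UNIV (\<lambda>(u, z). f t u z))"

definition solves_ivp ::
  "real \<Rightarrow> real \<Rightarrow> (real \<Rightarrow> real \<Rightarrow> real \<Rightarrow> real) \<Rightarrow> real \<Rightarrow> real \<Rightarrow>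
   (real \<Rightarrow> real) \<Rightarrow> (real \<Rightarrow> real) \<Rightarrow> bool" where
  "solves_ivp t0 T f y0 dy0 y dy \<longleftrightarrow>
     y t0 = y0 \<and> dy t0 = dy0 \<and>
     (\<forall>t\<in>{t0..t0+T}.
        (y has_real_derivative dy t) (at t within {t0..t0+T}) \<and>
        (dy has_real_derivative f t (y t) (dy t)) (at t within {t0..t0+T}))"

definition collocation_coeffs ::
  "real^'s \<Rightarrow> real^'s \<Rightarrow> real^'s \<Rightarrow> real^'s^'s \<Rightarrow> real^'s^'s \<Rightarrow> bool" where
  "collocation_coeffs c b d A B \<longleftrightarrow>
     (\<forall>k<CARD('s).
        1 = real ((k+2) * (k+1)) * (b \<bullet> c ^ k) \<and>
        1 = real (k+1) * (d \<bullet> c ^ k) \<and>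
        c ^ (k+2) = real ((k+2) * (k+1)) *\<^sub>R (A *v (c - 1) ^ k) \<and>
        c ^ (k+1) = real (k+1) *\<^sub>R (B *v (c - 1) ^ k))"

text \<open>A state collects \<open>(y\<^sub>n, y'\<^sub>n, Y\<^sub>n, Y'\<^sub>n)\<close>.\<close>

type_synonym 's state = "real \<times> real \<times> (real^'s) \<times> (real^'s)"

fun geptrkn_step ::
  "(real \<Rightarrow> real \<Rightarrow> real \<Rightarrow> real) \<Rightarrow>
   real^'s \<Rightarrow> real^'s \<Rightarrow> real^'s \<Rightarrow> real^'s^'s \<Rightarrow> real^'s^'s \<Rightarrow>
   real \<Rightarrow> real \<Rightarrow> 's state \<Rightarrow> 's state" where
  "geptrkn_step f c b d A B h t (u, du, U, dU) =
     (let F = (\<chi> i. f (t + c$i * h) (U$i) (dU$i));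
          u1 = u + h * du + h^2 * (b \<bullet> F);
          du1 = du + h * (d \<bullet> F)
      in (u1, du1,
          vec u1 + (h * du1) *\<^sub>R c + h^2 *\<^sub>R (A *v F),
          vec du1 + h *\<^sub>R (B *v F)))"

definition exact_state ::
  "(real \<Rightarrow> real) \<Rightarrow> (real \<Rightarrow> real) \<Rightarrow> real^'s \<Rightarrow> real \<Rightarrow> real \<Rightarrow> 's state" where
  "exact_state y dy c h t = (y t, dy t, (\<chi> i. y (t + c$i * h)), (\<chi> i. dy (t + c$i * h)))"

fun state_errors_le ::
  "real \<Rightarrow> real \<Rightarrow> nat \<Rightarrow> nat \<Rightarrow> nat \<Rightarrow> nat \<Rightarrow> 's::finite state \<Rightarrow> 's state \<Rightarrow> bool" where
  "state_errors_le K h p1 p2 p3 p4 (u, du, U, dU) (v, dv, V, dV) \<longleftrightarrow>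
     \<bar>u - v\<bar> \<le> K * h^(p1+1) \<and> \<bar>du - dv\<bar> \<le> K * h^(p2+1) \<and>
     norm (U - V) \<le> K * h^(p3+1) \<and> norm (dU - dV) \<le> K * h^(p4+1)"

definition points_in :: "real set \<Rightarrow> real^'s \<Rightarrow> real \<Rightarrow> real \<Rightarrow> bool" where
  "points_in I c h t \<longleftrightarrow>
     t \<in> I \<and> t + h \<in> I \<and> (\<forall>i. t + c$i * h \<in> I \<and> t + h + c$i * h \<in> I)"

text \<open>
  Step order \<open>p\<close> and stage order \<open>r\<close> for one problem with exact solution \<open>y\<close>, \<open>dy = y'\<close>
  on \<open>I\<close>.  The constant \<open>C\<close> in the conclusion depends on the problem, the method and the
  constant \<open>K\<close> in the hypotheses, but neither on the step-size \<open>h\<close>, nor on the current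
  point \<open>t = t\<^sub>n\<close>, nor on the approximations \<open>w\<close>.  The orders are attained in the sense that
  the estimates hold; nothing is said about their failure for larger exponents.
\<close>

definition geptrkn_orders ::
  "real set \<Rightarrow> (real \<Rightarrow> real \<Rightarrow> real \<Rightarrow> real) \<Rightarrow> (real \<Rightarrow> real) \<Rightarrow> (real \<Rightarrow> real) \<Rightarrow>
   real^'s \<Rightarrow> real^'s \<Rightarrow> real^'s \<Rightarrow> real^'s^'s \<Rightarrow> real^'s^'s \<Rightarrow> nat \<Rightarrow> nat \<Rightarrow> bool" where
  "geptrkn_orders I f y dy c b d A B p r \<longleftrightarrow>
     (\<exists>p1 p2 p3 p4. p = min p1 p2 \<and> r = Min {p1, p2, p3, p4} \<and>
       (\<forall>K. \<exists>C. \<forall>\<^sub>F h in at_right 0. \<forall>t w.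
          points_in I c h t \<longrightarrow>
          state_errors_le K h p1 p2 p3 p4 (exact_state y dy c h t) w \<longrightarrow>
          state_errors_le C h p1 p2 p3 p4 (exact_state y dy c h (t + h))
            (geptrkn_step f c b d A B h t w)))"

end

theory Submission
  imports Defs
begin

text \<open>
  All four errors are of size \<open>O(h\<^sup>s\<^sup>+\<^sup>1)\<close>, where \<open>s\<close> is the number of stages, so \<open>s\<close> serves
  as each of the four exponents \<open>p\<^sub>1, \<dots>, p\<^sub>4\<close>, and both minima are then \<open>s\<close>.  The error of one
  step has two sources.

  The first source is the method itself, applied to exact data.  Taylor's formula with
  integral remainder presents each component of the exact state as \<open>y(\<tau>) + \<theta> h y'(\<tau>)\<close>, or
  \<open>y'(\<tau>)\<close>, plus an iterated integral of \<open>y''\<close> of length \<open>\<theta> h\<close>, and the method replaces this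
  integral by a weighted sum of values of \<open>y''\<close>.  The collocation conditions say that this
  quadrature is exact for polynomials of degree below \<open>s\<close>: the monomials in \<open>c\<close> are the
  expansion about \<open>\<tau> = t\<close>, used for \<open>b\<close> and \<open>d\<close>, while those in \<open>c - 1\<close> are the expansion
  about \<open>\<tau> = t + h\<close>, used for the rows of \<open>A\<close> and \<open>B\<close>, because in units of \<open>h\<close> the points
  \<open>t + c\<^sub>i h\<close> where the right-hand side is sampled lie at \<open>c\<^sub>i - 1\<close> from there.  All four
  families of conditions are therefore instances of one statement,
  \<open>collocation_quadrature_error\<close>, with integration order \<open>m = 2\<close> or \<open>m = 1\<close> and error
  \<open>O(h\<^sup>m\<^sup>+\<^sup>s)\<close>.

  The second source is the error in the data.  By the Lipschitz condition an error of size
  \<open>O(h\<^sup>s\<^sup>+\<^sup>1)\<close> in the stages becomes one of the same size in the sampled right-hand sides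
  (\<open>rhs_perturbation\<close>), and a step of the method never multiplies it by a negative power of
  \<open>h\<close>, so for \<open>h < 1\<close> it stays of this size.

  Two derivatives beyond \<open>s\<close> suffice: \<open>y''\<close> must be expanded up to degree \<open>s - 1\<close>, and the
  remainder needs a bound on \<open>y\<^sup>(\<^sup>s\<^sup>+\<^sup>2\<^sup>)\<close>, which is continuous on a compact interval.  This
  bound makes the constants independent of the current point \<open>t\<close>.
\<close>

section \<open>Iterated derivatives on an interval\<close>

text \<open>
  On the real line a Frechet derivative is multiplication by its value at \<open>1\<close>, so the nested
  existential quantifiers of \<^const>\<open>Ck_on\<close> unfold to a single sequence of derivatives.
\<close>

lemma Ck_on_real_derivatives:
  fixes g :: "real \<Rightarrow> real"
  assumes "Ck_on N S g"
  obtains G where "G 0 = g"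
    and "\<And>k x. k < N \<Longrightarrow> x \<in> S \<Longrightarrow> (G k has_real_derivative G (Suc k) x) (at x within S)"
    and "continuous_on S (G N)"
proof -
  have "\<exists>G. G 0 = g \<and>
      (\<forall>k<N. \<forall>x\<in>S. (G k has_real_derivative G (Suc k) x) (at x within S)) \<and>
      continuous_on S (G N)"
    using assms
  proof (induction N arbitrary: g)
    case 0
    then show ?case by (intro exI[of _ "\<lambda>_. g"]) auto
  next
    case (Suc N)
    then obtain D where D: "\<And>x. x \<in> S \<Longrightarrow> (g has_derivative D x) (at x within S)"
      and CD: "Ck_on N S (\<lambda>x. D x 1)"
      by (auto simp del: One_nat_def) metis
    have g': "(g has_real_derivative D x 1) (at x within S)" if "x \<in> S" for x
    proof -
      have "D x = (*) (D x 1)"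
      proof
        fix v
        show "D x v = D x 1 * v"
          using linear_scale[OF has_derivative_linear[OF D[OF that]], of v 1]
          by (simp add: mult.commute)
      qed
      then show ?thesis using D[OF that] by (simp add: has_field_derivative_def)
    qed
    obtain G where G: "G 0 = (\<lambda>x. D x 1)"
      "\<forall>k<N. \<forall>x\<in>S. (G k has_real_derivative G (Suc k) x) (at x within S)"
      "continuous_on S (G N)"
      using Suc.IH[OF CD] by blast
    show ?case
    proof (intro exI[of _ "\<lambda>k. case k of 0 \<Rightarrow> g | Suc j \<Rightarrow> G j"] conjI allI impI ballI)
      fix k x assume "k < Suc N" "x \<in> S"
      then show "((case k of 0 \<Rightarrow> g | Suc j \<Rightarrow> G j) has_real_derivative
          (case Suc k of 0 \<Rightarrow> g | Suc j \<Rightarrow> G j) x) (at x within S)"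
        using G g' by (cases k) auto
    qed (use G in auto)
  qed
  then show ?thesis using that by blast
qed

lemma has_real_derivative_unique_within_Icc:
  fixes g :: "real \<Rightarrow> real"
  assumes "a < b" "x \<in> {a..b}"
    and "(g has_real_derivative p) (at x within {a..b})"
    and "(g has_real_derivative q) (at x within {a..b})"
  shows "p = q"
  using assms vector_derivative_unique_within_closed_interval[of a b x g p q]
  by (simp add: has_real_derivative_iff_has_vector_derivative)

section \<open>The quadrature error\<close>

text \<open>
  With \<open>G k\<close> the \<open>k\<close>-th derivative of \<open>G 0\<close>, the sum over \<open>i\<close> with weights \<open>w\<close> and nodes
  \<open>\<xi>\<close> stands for the \<open>m\<close>-fold integral of \<open>G m\<close> over a length \<open>\<theta> h\<close>, and the hypothesis
  on \<open>w\<close> is exactness of this formula for \<open>x\<^sup>k\<close>, \<open>k < s\<close>, whose \<open>m\<close>-fold integral is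
  \<open>k! x\<^sup>k\<^sup>+\<^sup>m / (k+m)!\<close>.  Hence the Taylor polynomial of \<open>G 0\<close> of degree \<open>m + s - 1\<close> is
  reproduced exactly, and only the remainders of \<open>G 0\<close> and of the sampled \<open>G m\<close> are left.
  Since \<open>\<theta>\<close> and the nodes may have either sign, the lemma asks that all points lie in the
  convex set \<open>I\<close> on which the last derivative is bounded.
\<close>

lemma collocation_quadrature_error:
  fixes G :: "nat \<Rightarrow> real \<Rightarrow> real" and w \<xi> :: "real^'s"
  assumes I: "convex I"
    and G: "\<And>k x. k < m + s \<Longrightarrow> x \<in> I \<Longrightarrow> (G k has_real_derivative G (Suc k) x) (at x within I)"
    and M: "\<And>x. x \<in> I \<Longrightarrow> \<bar>G (m + s) x\<bar> \<le> M"
    and s: "0 < s"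
    and rule: "\<And>k. k < s \<Longrightarrow> fact k * \<theta> ^ (k + m) = fact (k + m) * (w \<bullet> \<xi> ^ k)"
  shows "\<exists>C\<ge>0. \<forall>\<tau> h. 0 \<le> h \<longrightarrow> \<tau> \<in> I \<longrightarrow> \<tau> + \<theta> * h \<in> I \<longrightarrow> (\<forall>i. \<tau> + \<xi>$i * h \<in> I) \<longrightarrow>
    \<bar>G 0 (\<tau> + \<theta> * h) - (\<Sum>j<m. G j \<tau> * (\<theta> * h) ^ j / fact j)
      - h ^ m * (w \<bullet> (\<chi> i. G m (\<tau> + \<xi>$i * h)))\<bar> \<le> C * h ^ (m + s)"
proof -
  define C where "C = \<bar>M\<bar> * \<bar>\<theta>\<bar> ^ (m + s) + (\<Sum>i\<in>UNIV. \<bar>w$i\<bar> * (\<bar>M\<bar> * \<bar>\<xi>$i\<bar> ^ s))"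
  have taylor: "\<bar>G j z - (\<Sum>i<n. G (j + i) \<tau> * (z - \<tau>) ^ i / fact i)\<bar> \<le> \<bar>M\<bar> * \<bar>z - \<tau>\<bar> ^ n"
    if "\<tau> \<in> I" "z \<in> I" "j + n = m + s" "0 < n" for j n \<tau> z
  proof -
    obtain n' where n': "n = Suc n'" using \<open>0 < n\<close> gr0_conv_Suc by blast
    have "norm (G (j + 0) z - (\<Sum>i\<le>n'. G (j + i) \<tau> * (z - \<tau>) ^ i / fact i))
        \<le> \<bar>M\<bar> * norm (z - \<tau>) ^ Suc n' / fact n'"
    proof (rule field_Taylor[OF I, of n' "\<lambda>i. G (j + i)"])
      fix i x assume "x \<in> I" "i \<le> n'"
      then show "(G (j + i) has_real_derivative G (j + Suc i) x) (at x within I)"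
        using G[of "j + i" x] that n' by simp
    next
      fix x assume "x \<in> I"
      then show "norm (G (j + Suc n') x) \<le> \<bar>M\<bar>"
        using M[of x] that n' by simp
    qed (use that in auto)
    also have "\<dots> \<le> \<bar>M\<bar> * norm (z - \<tau>) ^ Suc n' / 1"
      by (intro divide_left_mono) (auto simp: fact_ge_1)
    finally show ?thesis
      by (simp add: n' lessThan_Suc_atMost)
  qed
  have "\<bar>G 0 (\<tau> + \<theta> * h) - (\<Sum>j<m. G j \<tau> * (\<theta> * h) ^ j / fact j)
      - h ^ m * (w \<bullet> (\<chi> i. G m (\<tau> + \<xi>$i * h)))\<bar> \<le> C * h ^ (m + s)"
    if h: "0 \<le> h" and \<tau>: "\<tau> \<in> I" and z: "\<tau> + \<theta> * h \<in> I"
      and x: "\<And>i. \<tau> + \<xi>$i * h \<in> I" for \<tau> h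
  proof -
    \<comment> \<open>Both remainders are taken to the same derivative \<open>G (m + s)\<close>, which is why \<open>G 0\<close> is
      expanded to \<open>m + s\<close> terms but \<open>G m\<close> only to \<open>s\<close>.\<close>
    define R0 where "R0 = G 0 (\<tau> + \<theta> * h) - (\<Sum>i<m + s. G i \<tau> * (\<theta> * h) ^ i / fact i)"
    define P where "P i = (\<Sum>k<s. G (m + k) \<tau> * (\<xi>$i * h) ^ k / fact k)" for i
    define R where "R i = G m (\<tau> + \<xi>$i * h) - P i" for i
    have R0: "\<bar>R0\<bar> \<le> \<bar>M\<bar> * \<bar>\<theta>\<bar> ^ (m + s) * h ^ (m + s)"
      using taylor[OF \<tau> z, of 0 "m + s"] s h
      by (simp add: R0_def abs_mult power_mult_distrib mult.assoc)
    have R: "\<bar>R i\<bar> \<le> \<bar>M\<bar> * \<bar>\<xi>$i\<bar> ^ s * h ^ s" for i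
      using taylor[OF \<tau> x[of i], of m s] s h
      by (simp add: R_def P_def abs_mult power_mult_distrib mult.assoc)
    have pow: "(\<xi> ^ k) $ i = \<xi>$i ^ k" for i k
      by (induction k) auto
    have "h ^ m * (\<Sum>i\<in>UNIV. w$i * P i)
        = (\<Sum>k<s. h ^ (m + k) * G (m + k) \<tau> / fact k * (\<Sum>i\<in>UNIV. w$i * \<xi>$i ^ k))"
      unfolding P_def sum_distrib_left
      by (subst sum.swap) (simp add: power_add power_mult_distrib field_simps)
    also have "\<dots> = (\<Sum>k<s. G (m + k) \<tau> * (\<theta> * h) ^ (m + k) / fact (m + k))"
    proof (rule sum.cong[OF refl])
      fix k assume "k \<in> {..<s}"
      then have "(\<Sum>i\<in>UNIV. w$i * \<xi>$i ^ k) = fact k * \<theta> ^ (m + k) / fact (m + k)"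
        using rule[of k] by (simp add: inner_vec_def pow add.commute field_simps)
      then show "h ^ (m + k) * G (m + k) \<tau> / fact k * (\<Sum>i\<in>UNIV. w$i * \<xi>$i ^ k)
          = G (m + k) \<tau> * (\<theta> * h) ^ (m + k) / fact (m + k)"
        by (simp add: power_mult_distrib)
    qed
    finally have quad: "h ^ m * (\<Sum>i\<in>UNIV. w$i * P i)
        = (\<Sum>k<s. G (m + k) \<tau> * (\<theta> * h) ^ (m + k) / fact (m + k))" .
    have split: "(\<Sum>i<m + s. G i \<tau> * (\<theta> * h) ^ i / fact i)
        = (\<Sum>j<m. G j \<tau> * (\<theta> * h) ^ j / fact j)
          + (\<Sum>k<s. G (m + k) \<tau> * (\<theta> * h) ^ (m + k) / fact (m + k))"
      by (induction s) auto
    have "w \<bullet> (\<chi> i. G m (\<tau> + \<xi>$i * h)) = (\<Sum>i\<in>UNIV. w$i * P i) + (\<Sum>i\<in>UNIV. w$i * R i)"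
      by (simp add: inner_vec_def R_def algebra_simps sum.distrib[symmetric])
    then have "G 0 (\<tau> + \<theta> * h) - (\<Sum>j<m. G j \<tau> * (\<theta> * h) ^ j / fact j)
      - h ^ m * (w \<bullet> (\<chi> i. G m (\<tau> + \<xi>$i * h))) = R0 - h ^ m * (\<Sum>i\<in>UNIV. w$i * R i)"
      using split quad by (simp add: R0_def distrib_left)
    moreover have "\<bar>h ^ m * (\<Sum>i\<in>UNIV. w$i * R i)\<bar>
        \<le> h ^ m * (\<Sum>i\<in>UNIV. \<bar>w$i\<bar> * (\<bar>M\<bar> * \<bar>\<xi>$i\<bar> ^ s * h ^ s))"
      unfolding abs_mult using h
      by (intro mult_mono order_trans[OF sum_abs] sum_mono)
         (auto simp: abs_mult intro!: mult_left_mono R sum_nonneg)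
    moreover have "\<dots> = (\<Sum>i\<in>UNIV. \<bar>w$i\<bar> * (\<bar>M\<bar> * \<bar>\<xi>$i\<bar> ^ s)) * h ^ (m + s)"
      by (simp add: sum_distrib_left sum_distrib_right power_add mult_ac)
    ultimately show ?thesis
      using R0 unfolding C_def distrib_right by linarith
  qed
  moreover have "0 \<le> C" unfolding C_def by (intro add_nonneg_nonneg sum_nonneg) auto
  ultimately show ?thesis by blast
qed

section \<open>Propagation of errors through one step\<close>

text \<open>
  The factor \<open>2\<close> comes from estimating the norm of a pair by the sum of the norms of its
  entries, and the factor \<open>s\<close> from estimating the norm of a vector by the sum of its entries.
\<close>

lemma rhs_perturbation:
  fixes f :: "real \<Rightarrow> real \<Rightarrow> real \<Rightarrow> real" and U dU V dV :: "real^'s"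
  assumes lip: "\<And>i. L-lipschitz_on UNIV (\<lambda>(u, z). f (\<tau> i) u z)"
    and U: "norm (U - V) \<le> \<epsilon>" and dU: "norm (dU - dV) \<le> \<epsilon>"
  shows "norm ((\<chi> i. f (\<tau> i) (U$i) (dU$i)) - (\<chi> i. f (\<tau> i) (V$i) (dV$i)))
    \<le> real CARD('s) * (L * (2 * \<epsilon>))"
proof -
  have comp: "\<bar>f (\<tau> i) (U$i) (dU$i) - f (\<tau> i) (V$i) (dV$i)\<bar> \<le> L * (2 * \<epsilon>)" for i
  proof -
    have "\<bar>U$i - V$i\<bar> \<le> \<epsilon>" "\<bar>dU$i - dV$i\<bar> \<le> \<epsilon>"
      using component_le_norm_cart[of "U - V" i] component_le_norm_cart[of "dU - dV" i] U dU
      by auto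
    then have "dist (U$i, dU$i) (V$i, dV$i) \<le> 2 * \<epsilon>"
      using norm_Pair_le[of "U$i - V$i" "dU$i - dV$i"] by (simp add: dist_norm)
    then have "L * dist (U$i, dU$i) (V$i, dV$i) \<le> L * (2 * \<epsilon>)"
      using lipschitz_on_nonneg[OF lip[of i]] by (rule mult_left_mono)
    then show ?thesis
      using lipschitz_onD[OF lip[of i], of "(U$i, dU$i)" "(V$i, dV$i)"] by (simp add: dist_norm)
  qed
  show ?thesis
    by (rule order_trans[OF norm_le_l1_cart]) (use sum_bounded_above[where A = UNIV, OF comp] in simp)
qed

text \<open>
  The core of the argument.  The derivatives of the solution are given here as a sequence \<open>G\<close>,
  so that the expansions of \<open>y\<close> and \<open>y'\<close> are the same lemma applied to \<open>G\<close> and to its shift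
  by one.  The differential equation enters only to identify \<open>G 2\<close> at the stage points with
  the right-hand side sampled at exact data.
\<close>

lemma geptrkn_orders_of_derivatives:
  fixes c b d :: "real^'s" and G :: "nat \<Rightarrow> real \<Rightarrow> real"
  defines "s \<equiv> CARD('s)"
  assumes coll: "collocation_coeffs c b d A B"
    and I: "convex I"
    and G: "\<And>k x. k < s + 2 \<Longrightarrow> x \<in> I \<Longrightarrow> (G k has_real_derivative G (Suc k) x) (at x within I)"
    and M: "\<And>x. x \<in> I \<Longrightarrow> \<bar>G (s + 2) x\<bar> \<le> M"
    and dy: "\<And>x. x \<in> I \<Longrightarrow> G 1 x = dy x"
    and ode: "\<And>x. x \<in> I \<Longrightarrow> G 2 x = f x (G 0 x) (dy x)"
    and lip: "\<And>x. x \<in> I \<Longrightarrow> L-lipschitz_on UNIV (\<lambda>(u, z). f x u z)"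
  shows "geptrkn_orders I f (G 0) dy c b d A B s s"
proof -
  have s: "0 < s" by (simp add: s_def)
  have pow: "(v ^ k) $ i = v$i ^ k" for v :: "real^'s" and i k
    by (induction k) auto
  have fact2: "fact (k + 2) = real ((k+2) * (k+1)) * fact k" for k
    by (simp add: algebra_simps)
  have fact1: "fact (k + 1) = real (k+1) * fact k" for k
    by (simp add: algebra_simps)
  have rules: "1 = real ((k+2) * (k+1)) * (b \<bullet> c ^ k)" "1 = real (k+1) * (d \<bullet> c ^ k)"
    "c$i ^ (k+2) = real ((k+2) * (k+1)) * (A$i \<bullet> (c - 1) ^ k)"
    "c$i ^ (k+1) = real (k+1) * (B$i \<bullet> (c - 1) ^ k)" if "k < s" for k i
  proof -
    have *: "1 = real ((k+2) * (k+1)) * (b \<bullet> c ^ k) \<and> 1 = real (k+1) * (d \<bullet> c ^ k) \<and>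
        c ^ (k+2) = real ((k+2) * (k+1)) *\<^sub>R (A *v (c - 1) ^ k) \<and>
        c ^ (k+1) = real (k+1) *\<^sub>R (B *v (c - 1) ^ k)"
      using coll that unfolding collocation_coeffs_def s_def by blast
    then show "1 = real ((k+2) * (k+1)) * (b \<bullet> c ^ k)" "1 = real (k+1) * (d \<bullet> c ^ k)"
      by blast+
    have "(c ^ (k+2)) $ i = (real ((k+2) * (k+1)) *\<^sub>R (A *v (c - 1) ^ k)) $ i"
      "(c ^ (k+1)) $ i = (real (k+1) *\<^sub>R (B *v (c - 1) ^ k)) $ i"
      using * by metis+
    then show "c$i ^ (k+2) = real ((k+2) * (k+1)) * (A$i \<bullet> (c - 1) ^ k)"
      "c$i ^ (k+1) = real (k+1) * (B$i \<bullet> (c - 1) ^ k)"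
      unfolding pow vector_scaleR_component matrix_vector_mul_component by simp_all
  qed
  have quad2: "\<exists>C\<ge>0. \<forall>\<tau> h. 0 \<le> h \<longrightarrow> \<tau> \<in> I \<longrightarrow> \<tau> + \<theta> * h \<in> I \<longrightarrow> (\<forall>i. \<tau> + \<xi>$i * h \<in> I) \<longrightarrow>
      \<bar>G 0 (\<tau> + \<theta> * h) - G 0 \<tau> - \<theta> * h * G 1 \<tau> - h\<^sup>2 * (w \<bullet> (\<chi> i. G 2 (\<tau> + \<xi>$i * h)))\<bar>
      \<le> C * h ^ (s + 2)"
    if "\<And>k. k < s \<Longrightarrow> \<theta> ^ (k+2) = real ((k+2) * (k+1)) * (w \<bullet> \<xi> ^ k)" for \<theta> and w \<xi> :: "real^'s"
  proof -
    have "fact k * \<theta> ^ (k + 2) = fact (k + 2) * (w \<bullet> \<xi> ^ k)" if "k < s" for k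
      unfolding fact2 \<open>\<And>k. k < s \<Longrightarrow> \<theta> ^ (k+2) = _\<close>[OF that] by simp
    then show ?thesis
      using collocation_quadrature_error[of I 2 s G M \<theta> w \<xi>] I G M s
      by (simp add: numeral_2_eq_2 algebra_simps)
  qed
  have quad1: "\<exists>C\<ge>0. \<forall>\<tau> h. 0 \<le> h \<longrightarrow> \<tau> \<in> I \<longrightarrow> \<tau> + \<theta> * h \<in> I \<longrightarrow> (\<forall>i. \<tau> + \<xi>$i * h \<in> I) \<longrightarrow>
      \<bar>G 1 (\<tau> + \<theta> * h) - G 1 \<tau> - h * (w \<bullet> (\<chi> i. G 2 (\<tau> + \<xi>$i * h)))\<bar> \<le> C * h ^ (s + 1)"
    if "\<And>k. k < s \<Longrightarrow> \<theta> ^ (k+1) = real (k+1) * (w \<bullet> \<xi> ^ k)" for \<theta> and w \<xi> :: "real^'s"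
  proof -
    have "fact k * \<theta> ^ (k + 1) = fact (k + 1) * (w \<bullet> \<xi> ^ k)" if "k < s" for k
      unfolding fact1 \<open>\<And>k. k < s \<Longrightarrow> \<theta> ^ (k+1) = _\<close>[OF that] by simp
    then show ?thesis
      using collocation_quadrature_error[of I 1 s "\<lambda>k. G (Suc k)" M \<theta> w \<xi>] I G M s
      by (simp add: numeral_2_eq_2 algebra_simps)
  qed
  obtain Cb where Cb: "Cb \<ge> 0"
    "\<And>\<tau> h. 0 \<le> h \<Longrightarrow> \<tau> \<in> I \<Longrightarrow> \<tau> + h \<in> I \<Longrightarrow> (\<forall>i. \<tau> + c$i * h \<in> I) \<Longrightarrow>
      \<bar>G 0 (\<tau> + h) - G 0 \<tau> - h * G 1 \<tau> - h\<^sup>2 * (b \<bullet> (\<chi> i. G 2 (\<tau> + c$i * h)))\<bar>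
      \<le> Cb * h ^ (s + 2)"
    using quad2[of 1 b c] rules(1) by auto
  obtain Cd where Cd: "Cd \<ge> 0"
    "\<And>\<tau> h. 0 \<le> h \<Longrightarrow> \<tau> \<in> I \<Longrightarrow> \<tau> + h \<in> I \<Longrightarrow> (\<forall>i. \<tau> + c$i * h \<in> I) \<Longrightarrow>
      \<bar>G 1 (\<tau> + h) - G 1 \<tau> - h * (d \<bullet> (\<chi> i. G 2 (\<tau> + c$i * h)))\<bar> \<le> Cd * h ^ (s + 1)"
    using quad1[of 1 d c] rules(2) by auto
  \<comment> \<open>For the stages the base point is \<open>\<tau> = t + h\<close>, and the nodes \<open>c - 1\<close> lead back to the
    points of the current step, \<open>\<tau> - h + c\<^sub>j h = t + c\<^sub>j h\<close>.\<close>
  have shift: "\<tau> + (c - 1)$i * h = \<tau> - h + c$i * h" for \<tau> h i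
    by (simp add: algebra_simps)
  have "\<exists>C. \<forall>i. C i \<ge> 0 \<and> (\<forall>\<tau> h. 0 \<le> h \<longrightarrow> \<tau> \<in> I \<longrightarrow> \<tau> + c$i * h \<in> I \<longrightarrow>
      (\<forall>j. \<tau> - h + c$j * h \<in> I) \<longrightarrow>
      \<bar>G 0 (\<tau> + c$i * h) - G 0 \<tau> - c$i * h * G 1 \<tau> - h\<^sup>2 * (A$i \<bullet> (\<chi> j. G 2 (\<tau> - h + c$j * h)))\<bar>
      \<le> C i * h ^ (s + 2))"
    using quad2[OF rules(3)] unfolding shift by (intro choice) blast
  then obtain CA where CA: "\<And>i. CA i \<ge> 0"
    "\<And>i \<tau> h. 0 \<le> h \<Longrightarrow> \<tau> \<in> I \<Longrightarrow> \<tau> + c$i * h \<in> I \<Longrightarrow> (\<forall>j. \<tau> - h + c$j * h \<in> I) \<Longrightarrow>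
      \<bar>G 0 (\<tau> + c$i * h) - G 0 \<tau> - c$i * h * G 1 \<tau> - h\<^sup>2 * (A$i \<bullet> (\<chi> j. G 2 (\<tau> - h + c$j * h)))\<bar>
      \<le> CA i * h ^ (s + 2)" by blast
  have "\<exists>C. \<forall>i. C i \<ge> 0 \<and> (\<forall>\<tau> h. 0 \<le> h \<longrightarrow> \<tau> \<in> I \<longrightarrow> \<tau> + c$i * h \<in> I \<longrightarrow>
      (\<forall>j. \<tau> - h + c$j * h \<in> I) \<longrightarrow>
      \<bar>G 1 (\<tau> + c$i * h) - G 1 \<tau> - h * (B$i \<bullet> (\<chi> j. G 2 (\<tau> - h + c$j * h)))\<bar>
      \<le> C i * h ^ (s + 1))"
    using quad1[OF rules(4)] unfolding shift by (intro choice) blast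
  then obtain CB where CB: "\<And>i. CB i \<ge> 0"
    "\<And>i \<tau> h. 0 \<le> h \<Longrightarrow> \<tau> \<in> I \<Longrightarrow> \<tau> + c$i * h \<in> I \<Longrightarrow> (\<forall>j. \<tau> - h + c$j * h \<in> I) \<Longrightarrow>
      \<bar>G 1 (\<tau> + c$i * h) - G 1 \<tau> - h * (B$i \<bullet> (\<chi> j. G 2 (\<tau> - h + c$j * h)))\<bar>
      \<le> CB i * h ^ (s + 1)" by blast
  have "\<exists>C. \<forall>\<^sub>F h in at_right 0. \<forall>t w. points_in I c h t \<longrightarrow>
      state_errors_le K h s s s s (exact_state (G 0) dy c h t) w \<longrightarrow>
      state_errors_le C h s s s s (exact_state (G 0) dy c h (t + h))
        (geptrkn_step f c b d A B h t w)" for K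
  proof -
    \<comment> \<open>Every error below is a multiple of \<open>h\<^sup>s\<^sup>+\<^sup>1\<close>: \<open>\<Phi>\<close> is the factor for the right-hand
      sides, \<open>E1\<close> and \<open>E2\<close> those for \<open>y\<^sub>n\<^sub>+\<^sub>1\<close> and its derivative, and \<open>E3 i\<close> and \<open>E4 i\<close> those for
      the stage components.  The stages are built from the computed \<open>y\<^sub>n\<^sub>+\<^sub>1\<close> and \<open>y'\<^sub>n\<^sub>+\<^sub>1\<close>,
      hence \<open>E1\<close> and \<open>E2\<close> reappear in \<open>E3\<close> and \<open>E4\<close>.\<close>
    define \<Phi> where "\<Phi> = real s * (L * (2 * K))"
    define E1 where "E1 = Cb + K + K + norm b * \<Phi>"
    define E2 where "E2 = Cd + K + norm d * \<Phi>"
    define E3 where "E3 i = CA i + E1 + \<bar>c$i\<bar> * E2 + norm (A$i) * \<Phi>" for i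
    define E4 where "E4 i = CB i + E2 + norm (B$i) * \<Phi>" for i
    define C where "C = Max {E1, E2, sum E3 UNIV, sum E4 UNIV}"
    have C: "E1 \<le> C" "E2 \<le> C" "sum E3 UNIV \<le> C" "sum E4 UNIV \<le> C"
      by (auto simp: C_def)
    have "state_errors_le C h s s s s (exact_state (G 0) dy c h (t + h))
        (geptrkn_step f c b d A B h t w)"
      if h: "0 < h" "h < 1" and pts: "points_in I c h t"
        and err: "state_errors_le K h s s s s (exact_state (G 0) dy c h t) w" for h t w
    proof -
      obtain u du U dU where w: "w = (u, du, U, dU)" by (cases w) auto
      define q where "q = h ^ (s + 1)"
      define Fx where "Fx = (\<chi> i. G 2 (t + c$i * h))"
      define F where "F = (\<chi> i. f (t + c$i * h) (U$i) (dU$i))"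
      define u1 where "u1 = u + h * du + h\<^sup>2 * (b \<bullet> F)"
      define du1 where "du1 = du + h * (d \<bullet> F)"
      have q: "0 \<le> q" and hq: "h ^ (s + 2) \<le> q"
        using h by (auto simp: q_def mult_left_le_one_le)
      \<comment> \<open>Here \<open>h < 1\<close> is used: factors \<open>h\<close> and \<open>h\<^sup>2\<close> in front of an error may be dropped.\<close>
      have shrink: "\<bar>h * x\<bar> \<le> \<bar>x\<bar>" "\<bar>h\<^sup>2 * x\<bar> \<le> \<bar>x\<bar>" for x
        using h by (auto simp: abs_mult power2_eq_square intro!: mult_left_le_one_le mult_le_one)
      have absorb: "a * h ^ (s + 2) \<le> a * q" if "0 \<le> a" for a
        using hq that by (rule mult_left_mono)
      have I': "t \<in> I" "t + h \<in> I" "\<And>i. t + c$i * h \<in> I" "\<And>i. t + h + c$i * h \<in> I"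
        using pts by (auto simp: points_in_def)
      have e: "\<bar>G 0 t - u\<bar> \<le> K * q" "\<bar>G 1 t - du\<bar> \<le> K * q"
        "norm ((\<chi> i. G 0 (t + c$i * h)) - U) \<le> K * q"
        "norm ((\<chi> i. dy (t + c$i * h)) - dU) \<le> K * q"
        using err I' dy by (simp_all add: w exact_state_def q_def)
      have "Fx = (\<chi> i. f (t + c$i * h) ((\<chi> i. G 0 (t + c$i * h))$i) ((\<chi> i. dy (t + c$i * h))$i))"
        by (simp add: Fx_def ode I')
      then have F: "norm (Fx - F) \<le> \<Phi> * q"
        using rhs_perturbation[of L f "\<lambda>i. t + c$i * h", OF lip e(3,4)] I'
        by (simp add: F_def \<Phi>_def s_def mult_ac)
      have inner: "\<bar>a \<bullet> (Fx - F)\<bar> \<le> norm a * \<Phi> * q" for a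
        using order_trans[OF Cauchy_Schwarz_ineq2 mult_left_mono[OF F norm_ge_zero]]
        by (simp add: mult.assoc)
      have e1: "\<bar>G 0 (t + h) - u1\<bar> \<le> E1 * q"
      proof -
        have "G 0 (t + h) - u1 = (G 0 (t + h) - G 0 t - h * G 1 t - h\<^sup>2 * (b \<bullet> Fx))
            + (G 0 t - u) + h * (G 1 t - du) + h\<^sup>2 * (b \<bullet> (Fx - F))"
          by (simp add: u1_def inner_diff_right algebra_simps)
        moreover have "\<bar>G 0 (t + h) - G 0 t - h * G 1 t - h\<^sup>2 * (b \<bullet> Fx)\<bar> \<le> Cb * q"
          using Cb(2)[of h t] absorb[OF Cb(1)] h I' by (force simp: Fx_def)
        ultimately show ?thesis
          using e(1,2) shrink(1)[of "G 1 t - du"] shrink(2)[of "b \<bullet> (Fx - F)"] inner[of b]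
          unfolding E1_def distrib_right by linarith
      qed
      have e2: "\<bar>G 1 (t + h) - du1\<bar> \<le> E2 * q"
      proof -
        have "G 1 (t + h) - du1 = (G 1 (t + h) - G 1 t - h * (d \<bullet> Fx))
            + (G 1 t - du) + h * (d \<bullet> (Fx - F))"
          by (simp add: du1_def inner_diff_right algebra_simps)
        moreover have "\<bar>G 1 (t + h) - G 1 t - h * (d \<bullet> Fx)\<bar> \<le> Cd * q"
          using Cd(2)[of h t] h I' by (force simp: Fx_def q_def)
        ultimately show ?thesis
          using e(2) shrink(1)[of "d \<bullet> (Fx - F)"] inner[of d]
          unfolding E2_def distrib_right by linarith
      qed
      have e3: "\<bar>G 0 (t + h + c$i * h) - (u1 + h * du1 * c$i + h\<^sup>2 * (A$i \<bullet> F))\<bar> \<le> E3 i * q" for i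
      proof -
        let ?R = "G 0 (t + h + c$i * h) - G 0 (t + h) - c$i * h * G 1 (t + h) - h\<^sup>2 * (A$i \<bullet> Fx)"
        have "G 0 (t + h + c$i * h) - (u1 + h * du1 * c$i + h\<^sup>2 * (A$i \<bullet> F))
            = ?R + (G 0 (t + h) - u1) + h * (c$i * (G 1 (t + h) - du1)) + h\<^sup>2 * (A$i \<bullet> (Fx - F))"
          by (simp add: inner_diff_right algebra_simps)
        moreover have "\<bar>?R\<bar> \<le> CA i * q"
          using CA(2)[of h "t + h" i] absorb[OF CA(1)[of i]] h I' by (force simp: Fx_def)
        moreover have "\<bar>c$i * (G 1 (t + h) - du1)\<bar> \<le> \<bar>c$i\<bar> * E2 * q"
          using mult_left_mono[OF e2, of "\<bar>c$i\<bar>"] by (simp add: abs_mult mult.assoc)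
        ultimately show ?thesis
          using e1 shrink(1)[of "c$i * (G 1 (t + h) - du1)"] shrink(2)[of "A$i \<bullet> (Fx - F)"]
            inner[of "A$i"]
          unfolding E3_def distrib_right by linarith
      qed
      have e4: "\<bar>G 1 (t + h + c$i * h) - (du1 + h * (B$i \<bullet> F))\<bar> \<le> E4 i * q" for i
      proof -
        let ?R = "G 1 (t + h + c$i * h) - G 1 (t + h) - h * (B$i \<bullet> Fx)"
        have "G 1 (t + h + c$i * h) - (du1 + h * (B$i \<bullet> F))
            = ?R + (G 1 (t + h) - du1) + h * (B$i \<bullet> (Fx - F))"
          by (simp add: inner_diff_right algebra_simps)
        moreover have "\<bar>?R\<bar> \<le> CB i * q"
          using CB(2)[of h "t + h" i] h I' by (force simp: Fx_def q_def)
        ultimately show ?thesis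
          using e2 shrink(1)[of "B$i \<bullet> (Fx - F)"] inner[of "B$i"]
          unfolding E4_def distrib_right by linarith
      qed
      have cart: "norm X \<le> C * q" if "\<And>i. \<bar>X$i\<bar> \<le> E i * q" "sum E UNIV \<le> C" for X :: "real^'s" and E
      proof -
        have "norm X \<le> (\<Sum>i\<in>UNIV. E i * q)"
          by (rule order_trans[OF norm_le_l1_cart sum_mono]) (rule that(1))
        also have "\<dots> \<le> C * q"
          using mult_right_mono[OF that(2) q] by (simp add: sum_distrib_right)
        finally show ?thesis .
      qed
      have step: "geptrkn_step f c b d A B h t w = (u1, du1,
          vec u1 + (h * du1) *\<^sub>R c + h\<^sup>2 *\<^sub>R (A *v F), vec du1 + h *\<^sub>R (B *v F))"
        by (simp add: w Let_def F_def u1_def du1_def)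
      have "norm ((\<chi> i. G 0 (t + h + c$i * h)) - (vec u1 + (h * du1) *\<^sub>R c + h\<^sup>2 *\<^sub>R (A *v F))) \<le> C * q"
        using e3 by (intro cart[OF _ C(3)]) (simp add: matrix_vector_mul_component)
      moreover have "norm ((\<chi> i. dy (t + h + c$i * h)) - (vec du1 + h *\<^sub>R (B *v F))) \<le> C * q"
        using e4 I' dy by (intro cart[OF _ C(4)]) (simp add: matrix_vector_mul_component)
      moreover have "\<bar>G 0 (t + h) - u1\<bar> \<le> C * q" "\<bar>dy (t + h) - du1\<bar> \<le> C * q"
        using e1 e2 mult_right_mono[OF C(1) q] mult_right_mono[OF C(2) q] dy[OF I'(2)] by auto
      ultimately show ?thesis
        unfolding step exact_state_def state_errors_le.simps q_def by blast
    qed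
    then have "\<forall>\<^sub>F h in at_right 0. \<forall>t w. points_in I c h t \<longrightarrow>
      state_errors_le K h s s s s (exact_state (G 0) dy c h t) w \<longrightarrow>
      state_errors_le C h s s s s (exact_state (G 0) dy c h (t + h))
        (geptrkn_step f c b d A B h t w)"
      by (intro eventually_mono[OF eventually_at_right_real[of 0 1]]) auto
    then show ?thesis by blast
  qed
  then show ?thesis
    unfolding geptrkn_orders_def by (intro exI[of _ s]) simp
qed

theorem theorem4p1:
  shows "\<exists>N::nat. \<forall>(c::real^'s) b d A B t0 T f y0 dy0 y dy.
    inj (\<lambda>i. c $ i) \<longrightarrow>
    collocation_coeffs c b d A B \<longrightarrow>
    0 < T \<longrightarrow>
    admissible_rhs t0 T f \<longrightarrow>
    Ck_on N ({t0..t0+T} \<times> UNIV) (\<lambda>(t, u, z). f t u z) \<longrightarrow>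
    solves_ivp t0 T f y0 dy0 y dy \<longrightarrow>
    Ck_on N {t0..t0+T} y \<longrightarrow>
    geptrkn_orders {t0..t0+T} f y dy c b d A B CARD('s) CARD('s)"
proof (intro exI[of _ "CARD('s) + 2"] allI impI)
  fix c b d :: "real^'s" and A B :: "real^'s^'s" and t0 T y0 dy0 :: real
    and f :: "real \<Rightarrow> real \<Rightarrow> real \<Rightarrow> real" and y dy :: "real \<Rightarrow> real"
  let ?I = "{t0..t0+T}"
  assume coll: "collocation_coeffs c b d A B" and T: "0 < T"
    and adm: "admissible_rhs t0 T f" and ivp: "solves_ivp t0 T f y0 dy0 y dy"
    and smooth: "Ck_on (CARD('s) + 2) ?I y"
  from smooth obtain G where G0: "G 0 = y"
    and G: "\<And>k x. k < CARD('s) + 2 \<Longrightarrow> x \<in> ?I \<Longrightarrow>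
      (G k has_real_derivative G (Suc k) x) (at x within ?I)"
    and cont: "continuous_on ?I (G (CARD('s) + 2))"
    by (rule Ck_on_real_derivatives) blast
  have unique: "p = q" if "x \<in> ?I" "(g has_real_derivative p) (at x within ?I)"
    "(g has_real_derivative q) (at x within ?I)" for g p q x
    using has_real_derivative_unique_within_Icc[OF _ that] T by simp
  have dy: "G 1 x = dy x" if "x \<in> ?I" for x
  proof (rule unique[OF that, of y])
    show "(y has_real_derivative G 1 x) (at x within ?I)"
      using G[of 0 x] that by (simp add: G0)
    show "(y has_real_derivative dy x) (at x within ?I)"
      using ivp that by (simp add: solves_ivp_def)
  qed
  have ode: "G 2 x = f x (G 0 x) (dy x)" if "x \<in> ?I" for x
  proof -
    have "(dy has_real_derivative f x (y x) (dy x)) (at x within ?I)"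
      using ivp that by (simp add: solves_ivp_def)
    then have "(G 1 has_real_derivative f x (y x) (dy x)) (at x within ?I)"
      by (rule has_field_derivative_transform_within[where d = 1]) (use that dy in auto)
    moreover have "(G 1 has_real_derivative G 2 x) (at x within ?I)"
      using G[of 1 x] that by (simp add: numeral_2_eq_2)
    ultimately show ?thesis
      unfolding G0 using unique[OF that] by blast
  qed
  obtain L where "\<forall>t\<in>?I. L-lipschitz_on UNIV (\<lambda>(u, z). f t u z)"
    using adm by (auto simp: admissible_rhs_def)
  moreover obtain M where "\<forall>x\<in>?I. \<bar>G (CARD('s) + 2) x\<bar> \<le> M"
    using compact_imp_bounded[OF compact_continuous_image[OF cont]]
    by (auto simp: bounded_iff)
  ultimately have "geptrkn_orders ?I f (G 0) dy c b d A B CARD('s) CARD('s)"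
    using geptrkn_orders_of_derivatives[where I = ?I and G = G and M = M and L = L
          and f = f and dy = dy, OF coll convex_real_interval(5) G _ dy ode] by blast
  then show "geptrkn_orders ?I f y dy c b d A B CARD('s) CARD('s)"
    unfolding G0 .
qed

end
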